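(* Let $N,d\ge 1$ and let $\mathbf{T}=\{\mathbf{t}_1,\dots,\mathbf{t}_N\}$ be a collection of random vectors with values in $\mathbb{R}^d$, each of which has a (finite) expected value $\mathbb{E}[\mathbf{t}_i]\in\mathbb{R}^d$ and covariance matrix $\operatorname{Cov}(\mathbf{t}_i,\mathbf{t}_i)\in\mathbb{R}^{d\times d}$. Put $\mu_{\mathbf{T}}=\frac1N\sum_{i=1}^N\mathbb{E}[\mathbf{t}_i]$. Then the uncertainty-aware covariance matrix $$\operatorname{Cov}(\mathbf{T},\mathbf{T}) := \frac1N\sum_{i=1}^N\left(\mathbb{E}\left[\mathbf{t}_i\mathbf{t}_i^{\mathsf T}\right]-\mu_{\mathbf{T}}\mu_{\mathbf{T}}^{\mathsf T}\right)$$ satisfies $$\operatorname{Cov}(\mathbf{T},\mathbf{T})=\frac1N\sum_{i=1}^N\mathbb{E}[\mathbf{t}_i]\,\mathbb{E}[\mathbf{t}_i]^{\mathsf T}+\frac1N\sum_{i=1}^N\operatorname{Cov}(\mathbf{t}_i,\mathbf{t}_i)-\mu_{\mathbf{T}}\mu_{\mathbf{T}}^{\mathsf T}.$$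
   Context: Vectors are column vectors and $^{\mathsf T}$ denotes transpose. For a random vector $\mathbf{x}$ in $\mathbb{R}^d$, $\operatorname{Cov}(\mathbf{x},\mathbf{x})=\mathbb{E}\left[(\mathbf{x}-\mathbb{E}[\mathbf{x}])(\mathbf{x}-\mathbb{E}[\mathbf{x}])^{\mathsf T}\right]$ is its covariance matrix. No assumption is made on the joint distribution of the $\mathbf{t}_i$; only the individual first and second moments of each $\mathbf{t}_i$ enter. *)

theory Defs
  imports "HOL-Probability.Probability"
begin

definition outer_prod :: "real ^ 'd \<Rightarrow> real ^ 'd \<Rightarrow> real ^ 'd ^ 'd" where
  "outer_prod v w = (columnvector v :: real ^ 1 ^ 'd) ** transpose (columnvector w :: real ^ 1 ^ 'd)"

lemma outer_prod_nth: "outer_prod v w $ i $ j = v $ i * w $ j"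
  by (simp add: outer_prod_def matrix_matrix_mult_def transpose_def columnvector_def)

definition cov_matrix :: "'a measure \<Rightarrow> ('a \<Rightarrow> real ^ 'd) \<Rightarrow> real ^ 'd ^ 'd" where
  "cov_matrix M x =
     (\<integral>\<omega>. outer_prod (x \<omega> - (\<integral>\<eta>. x \<eta> \<partial>M)) (x \<omega> - (\<integral>\<eta>. x \<eta> \<partial>M)) \<partial>M)"

(* The Bochner integral is 0 for non-integrable functions, so existence of the mean and of the
   covariance matrix is expressed by integrability of the integrands that define them. *)
definition has_mean_and_cov :: "'a measure \<Rightarrow> ('a \<Rightarrow> real ^ 'd) \<Rightarrow> bool" where
  "has_mean_and_cov M x \<longleftrightarrow>
     integrable M x \<and>
     integrable M (\<lambda>\<omega>. outer_prod (x \<omega> - (\<integral>\<eta>. x \<eta> \<partial>M)) (x \<omega> - (\<integral>\<eta>. x \<eta> \<partial>M)))"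

definition collection_mean :: "'a measure \<Rightarrow> nat \<Rightarrow> (nat \<Rightarrow> 'a \<Rightarrow> real ^ 'd) \<Rightarrow> real ^ 'd" where
  "collection_mean M N t = (1 / real N) *\<^sub>R (\<Sum>i=1..N. \<integral>\<omega>. t i \<omega> \<partial>M)"

definition uncertainty_cov :: "'a measure \<Rightarrow> nat \<Rightarrow> (nat \<Rightarrow> 'a \<Rightarrow> real ^ 'd) \<Rightarrow> real ^ 'd ^ 'd" where
  "uncertainty_cov M N t =
     (1 / real N) *\<^sub>R (\<Sum>i=1..N. (\<integral>\<omega>. outer_prod (t i \<omega>) (t i \<omega>) \<partial>M)
        - outer_prod (collection_mean M N t) (collection_mean M N t))"

end

theory Submission
  imports Defs
begin

text \<open>For a single vector x with mean m, the claim is the classical identity E[x x^T] = m m^T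
  + Cov(x,x), proved in \<open>second_moment_eq\<close>. It rests on bilinearity of the outer
  product (\<open>bounded_bilinear_outer_prod\<close>), which allows expanding around m and moving
  expectations past a fixed factor. Averaging over the collection gives the result; no joint
  distribution enters, because every expectation involves one t i only.\<close>

lemma bounded_bilinear_outer_prod:
  "bounded_bilinear (outer_prod :: real ^ 'd \<Rightarrow> real ^ 'd \<Rightarrow> real ^ 'd ^ 'd)"
proof -
  have "bilinear (outer_prod :: real ^ 'd \<Rightarrow> real ^ 'd \<Rightarrow> real ^ 'd ^ 'd)"
    unfolding bilinear_def
    by (auto intro!: linearI simp: vec_eq_iff outer_prod_nth algebra_simps)
  then show ?thesis
    by (simp add: bilinear_conv_bounded_bilinear)
qed

text \<open>After expansion around the mean, the two cross terms each integrate to m m^T, and the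
  constant correction removes one of these copies.\<close>

lemma (in prob_space) second_moment_eq:
  fixes x :: "'a \<Rightarrow> real ^ 'd"
  assumes "has_mean_and_cov M x"
  shows "(\<integral>\<omega>. outer_prod (x \<omega>) (x \<omega>) \<partial>M)
    = outer_prod (\<integral>\<omega>. x \<omega> \<partial>M) (\<integral>\<omega>. x \<omega> \<partial>M) + cov_matrix M x"
proof -
  define m where "m = (\<integral>\<omega>. x \<omega> \<partial>M)"
  interpret B: bounded_bilinear "outer_prod :: real ^ 'd \<Rightarrow> real ^ 'd \<Rightarrow> real ^ 'd ^ 'd"
    by (rule bounded_bilinear_outer_prod)
  have x: "integrable M x"
    and c: "integrable M (\<lambda>\<omega>. outer_prod (x \<omega> - m) (x \<omega> - m))"
    using assms by (simp_all add: has_mean_and_cov_def m_def)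
  have l: "integrable M (\<lambda>\<omega>. outer_prod (x \<omega>) m)"
    and r: "integrable M (\<lambda>\<omega>. outer_prod m (x \<omega>))"
    by (rule integrable_bounded_linear[OF B.bounded_linear_left x]
        integrable_bounded_linear[OF B.bounded_linear_right x])+
  \<comment> \<open>The hypotheses give integrability of the centred product rather than of x x^T,
    so x x^T is rewritten pointwise as a sum of terms already known to be integrable.\<close>
  have "(\<integral>\<omega>. outer_prod (x \<omega>) (x \<omega>) \<partial>M)
    = (\<integral>\<omega>. outer_prod (x \<omega> - m) (x \<omega> - m) + outer_prod (x \<omega>) m + outer_prod m (x \<omega>)
          - outer_prod m m \<partial>M)"
    by (simp add: B.diff_left B.diff_right)
  also have "\<dots> = cov_matrix M x + (\<integral>\<omega>. outer_prod (x \<omega>) m \<partial>M)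
      + (\<integral>\<omega>. outer_prod m (x \<omega>) \<partial>M) - outer_prod m m"
    \<comment> \<open>The constant term integrates to itself because the total mass is 1.\<close>
    using c l r by (simp add: cov_matrix_def flip: m_def) (simp add: prob_space)
  also have "(\<integral>\<omega>. outer_prod (x \<omega>) m \<partial>M) = outer_prod m m"
    unfolding m_def by (rule integral_bounded_linear[OF B.bounded_linear_left x])
  also have "(\<integral>\<omega>. outer_prod m (x \<omega>) \<partial>M) = outer_prod m m"
    using integral_bounded_linear[OF B.bounded_linear_right x, of m] by (simp add: m_def)
  finally show ?thesis
    by (simp add: m_def)
qed

theorem mainTheorem1:
  fixes M :: "'a measure" and N :: nat and t :: "nat \<Rightarrow> 'a \<Rightarrow> real ^ 'd"
  assumes "prob_space M"
    and "N \<ge> 1"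
    and "\<And>i. i \<in> {1..N} \<Longrightarrow> t i \<in> borel_measurable M"
    and "\<And>i. i \<in> {1..N} \<Longrightarrow> has_mean_and_cov M (t i)"
  shows "uncertainty_cov M N t =
    (1 / real N) *\<^sub>R (\<Sum>i=1..N. outer_prod (\<integral>\<omega>. t i \<omega> \<partial>M) (\<integral>\<omega>. t i \<omega> \<partial>M))
    + (1 / real N) *\<^sub>R (\<Sum>i=1..N. cov_matrix M (t i))
    - outer_prod (collection_mean M N t) (collection_mean M N t)"
proof -
  interpret prob_space M by fact
  have "(\<Sum>i=1..N. (\<integral>\<omega>. outer_prod (t i \<omega>) (t i \<omega>) \<partial>M))
    = (\<Sum>i=1..N. outer_prod (\<integral>\<omega>. t i \<omega> \<partial>M) (\<integral>\<omega>. t i \<omega> \<partial>M)) + (\<Sum>i=1..N. cov_matrix M (t i))"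
    using assms(4) by (simp add: second_moment_eq sum.distrib)
  then show ?thesis
    \<comment> \<open>Since N is nonzero, the factor 1/N cancels the N equal copies of the outer
      product of the collection mean. Deleting \<open>sum_constant\<close> lets
      \<open>sum_constant_scaleR\<close> turn their sum into a real scaling.\<close>
    using assms(2)
    by (simp add: uncertainty_cov_def sum_subtractf scaleR_right_diff_distrib
        scaleR_right_distrib sum_constant_scaleR del: sum_constant)
qed

end
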